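(* Let $X$ be a topological space in which every open set is a union of countably many clopen sets. The following are equivalent: (1) $X$ has the bounded-ideal convergence property; (2) $C_p(X)$ is an $\alpha_1$ space; (3) every Borel image of $X$ in $\mathbb{N}^{\mathbb{N}}$ is bounded.
   Context: For an ideal $\mathcal{I}$ on a countable set $D$ (containing singletons, closed under subsets and finite unions), $\mathcal{I}^*=\{D\setminus A:A\in\mathcal{I}\}$. A family $\{f_d\}_{d\in D}$ of real functions on $X$ $\mathcal{I}$-converges to $0$ if for each $x\in X$ and $\epsilon>0$, $\{d:|f_d(x)|<\epsilon\}\in\mathcal{I}^*$. $X$ has the $\mathcal{I}$-convergence property if for each family $\{f_d\}_{d\in D}$ of continuous real-valued functions on $X$ that $\mathcal{I}$-converges to $0$ there is $A\in\mathcal{I}^*$ with $\{f_d\}_{d\in A}$ converging pointwise to $0$ (for each $x$, $\epsilon>0$, only finitely many $d\in A$ have $|f_d(x)|\ge\epsilon$). With $D=\mathbb{N}\times\mathbb{N}$ and $A_h=\{(n,m):m\le h(n)\}$ for $h\in\mathbb{N}^{\mathbb{N}}$, the bounded-ideal is $\mathcal{I}_b=\{B\subseteq\mathbb{N}\times\mathbb{N}:\exists h\in\mathbb{N}^{\mathbb{N}},\ B\subseteq A_h\}$; the bounded-ideal convergence property is the $\mathcal{I}_b$-convergence property. $C_p(X)$: continuous real functions with pointwise topology. A countable set converges to $y$ if some (every) bijective enumeration does; $Y$ is $\alpha_1$ if for each $y$ and countably infinite sets $A_n$ converging to $y$ there are cofinite $B_n\subseteq A_n$ with $\bigcup_nB_n$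 converging to $y$. $Y\subseteq\mathbb{N}^{\mathbb{N}}$ is bounded if some $g$ satisfies $f(n)\le g(n)$ for all but finitely many $n$, for each $f\in Y$; a Borel image is $\Psi[X]$ for Borel measurable $\Psi$. *)

theory Defs
  imports "HOL-Analysis.Analysis"
begin

definition clopen_countable_union_property :: "'a::topological_space itself \<Rightarrow> bool" where
  "clopen_countable_union_property _ \<longleftrightarrow>
     (\<forall>U::'a set. open U \<longrightarrow>
        (\<exists>C::nat \<Rightarrow> 'a set. (\<forall>n. open (C n) \<and> closed (C n)) \<and> U = (\<Union>n. C n)))"

text \<open>Ideals on a countable index type 'd (the whole type plays the role of D).\<close>

definition dual_filter :: "'d set set \<Rightarrow> 'd set set" where
  "dual_filter I = {UNIV - A | A. A \<in> I}"

definition I_converges_to_zero :: "'d set set \<Rightarrow> ('d \<Rightarrow> 'a \<Rightarrow> real) \<Rightarrow> bool" where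
  "I_converges_to_zero I f \<longleftrightarrow>
     (\<forall>x \<epsilon>. \<epsilon> > 0 \<longrightarrow> {d. \<bar>f d x\<bar> < \<epsilon>} \<in> dual_filter I)"

definition pointwise_converges_to_zero_on :: "'d set \<Rightarrow> ('d \<Rightarrow> 'a \<Rightarrow> real) \<Rightarrow> bool" where
  "pointwise_converges_to_zero_on A f \<longleftrightarrow>
     (\<forall>x \<epsilon>. \<epsilon> > 0 \<longrightarrow> finite {d \<in> A. \<bar>f d x\<bar> \<ge> \<epsilon>})"

definition ideal_convergence_property :: "'d set set \<Rightarrow> 'a::topological_space itself \<Rightarrow> bool" where
  "ideal_convergence_property I _ \<longleftrightarrow>
     (\<forall>f :: 'd \<Rightarrow> 'a \<Rightarrow> real.
        (\<forall>d. continuous_on UNIV (f d)) \<and> I_converges_to_zero I f \<longrightarrow>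
        (\<exists>A \<in> dual_filter I. pointwise_converges_to_zero_on A f))"

definition A_h :: "(nat \<Rightarrow> nat) \<Rightarrow> (nat \<times> nat) set" where
  "A_h h = {(n, m). m \<le> h n}"

definition bounded_ideal :: "(nat \<times> nat) set set" where
  "bounded_ideal = {B. \<exists>h. B \<subseteq> A_h h}"

definition bounded_ideal_convergence_property :: "'a::topological_space itself \<Rightarrow> bool" where
  "bounded_ideal_convergence_property X \<longleftrightarrow> ideal_convergence_property bounded_ideal X"

text \<open>C_p(X): continuous real functions, with the pointwise (product) topology
  of type 'a \<Rightarrow> real.\<close>

definition Cp :: "'a::topological_space itself \<Rightarrow> ('a \<Rightarrow> real) set" where
  "Cp _ = {f. continuous_on UNIV f}"

definition set_converges_to :: "'b::topological_space set \<Rightarrow> 'b \<Rightarrow> bool" where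
  "set_converges_to A y \<longleftrightarrow> (\<exists>e::nat \<Rightarrow> 'b. bij_betw e UNIV A \<and> e \<longlonglongrightarrow> y)"

definition alpha1 :: "'b::topological_space set \<Rightarrow> bool" where
  "alpha1 Y \<longleftrightarrow>
     (\<forall>y \<in> Y. \<forall>A :: nat \<Rightarrow> 'b set.
        (\<forall>n. A n \<subseteq> Y \<and> countable (A n) \<and> infinite (A n) \<and> set_converges_to (A n) y) \<longrightarrow>
        (\<exists>B :: nat \<Rightarrow> 'b set. (\<forall>n. B n \<subseteq> A n \<and> finite (A n - B n)) \<and>
              set_converges_to (\<Union>n. B n) y))"

definition bounded_baire :: "(nat \<Rightarrow> nat) set \<Rightarrow> bool" where
  "bounded_baire Y \<longleftrightarrow> (\<exists>g. \<forall>f \<in> Y. finite {n. \<not> f n \<le> g n})"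

text \<open>Borel images of X in N^N (N^N with its product topology, Borel sigma-algebras).\<close>

definition borel_images_bounded :: "'a::topological_space itself \<Rightarrow> bool" where
  "borel_images_bounded _ \<longleftrightarrow>
     (\<forall>\<Psi> :: 'a \<Rightarrow> (nat \<Rightarrow> nat). \<Psi> \<in> borel_measurable borel \<longrightarrow> bounded_baire (range \<Psi>))"

end

(*
Since f (n, m) --> 0 as m --> \<infinity> for each n, the modulus
n |-> least N with |f (n, m) x| \<le> 1/(n+1) for all m \<ge> N is a Borel function of x, and any h
dominating all these moduli witnesses the bounded-ideal convergence property. Enumerating the sets A n
then gives the alpha_1 property; conversely, adding small generic constants to a family
makes its members pairwise distinct, so that alpha_1 applies to it.

To bound Borel images, apply the convergence property to indicator functions of clopen sets C n m,
point-finite for each n: some h makes {C n m | m > h n} point-finite as a whole. If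
G is the intersection of decreasing U n and C n j (j = 0, 1, ...) is a clopen partition of U n,
then each point of G lies in the closed set \<Union>j\<le>h n. C n j for almost all n, so G is an F_sigma.
Hence all Borel sets are F_sigma, each {x. \<Psi> x n \<le> k} is F_sigma, and \<Psi> is dominated by a \<Theta> with
{x. \<Theta> x n \<le> k} closed; the same clopen argument applied to the open sets {x. \<Theta> x n > k} bounds \<Theta>.
*)
theory Submission
  imports Defs
begin

section \<open>Convergence in function spaces and the bounded ideal in elementary terms\<close>

lemma tendsto_fun_iff:
  fixes y :: "'a \<Rightarrow> 'b::topological_space"
  shows "(f \<longlongrightarrow> y) F \<longleftrightarrow> (\<forall>x. ((\<lambda>i. f i x) \<longlongrightarrow> y x) F)"
  using limitin_componentwise[of "\<lambda>_::'a. euclidean :: 'b topology" UNIV f y F]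
  by (simp add: euclidean_product_topology)

lemma LIMSEQ_iff_finite_ge:
  fixes a :: "nat \<Rightarrow> real"
  shows "a \<longlonglongrightarrow> l \<longleftrightarrow> (\<forall>\<epsilon>>0. finite {k. \<epsilon> \<le> \<bar>a k - l\<bar>})"
  by (simp add: tendsto_iff dist_real_def cofinite_eq_sequentially[symmetric] eventually_cofinite
      not_less)

text \<open>A bijective enumeration carries its exceptional indices bijectively onto the exceptional
  members of \<open>A\<close>, so convergence does not depend on the enumeration chosen. Later
  arguments can then count functions instead of indices.\<close>

lemma set_converges_to_real_fun_iff:
  fixes y :: "'a \<Rightarrow> real"
  shows "set_converges_to A y \<longleftrightarrow>
    countable A \<and> infinite A \<and> (\<forall>x. \<forall>\<epsilon>>0. finite {f \<in> A. \<epsilon> \<le> \<bar>f x - y x\<bar>})"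
proof -
  have fin: "finite {k. \<epsilon> \<le> \<bar>e k x - y x\<bar>} \<longleftrightarrow> finite {f \<in> A. \<epsilon> \<le> \<bar>f x - y x\<bar>}"
    if e: "bij_betw e (UNIV::nat set) A" for e x \<epsilon>
  proof -
    have eq: "e ` {k. \<epsilon> \<le> \<bar>e k x - y x\<bar>} = {f \<in> A. \<epsilon> \<le> \<bar>f x - y x\<bar>}"
      using e by (auto simp: bij_betw_def)
    have "inj_on e {k. \<epsilon> \<le> \<bar>e k x - y x\<bar>}"
      using e by (auto simp: bij_betw_def intro: inj_on_subset)
    from finite_image_iff[OF this] show ?thesis
      unfolding eq by (rule sym)
  qed
  have conv: "e \<longlonglongrightarrow> y \<longleftrightarrow> (\<forall>x. \<forall>\<epsilon>>0. finite {f \<in> A. \<epsilon> \<le> \<bar>f x - y x\<bar>})"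
    if "bij_betw e (UNIV::nat set) A" for e
    using fin[OF that] by (simp add: tendsto_fun_iff LIMSEQ_iff_finite_ge)
  show ?thesis
  proof
    assume "set_converges_to A y"
    then obtain e where e: "bij_betw e (UNIV::nat set) A" "e \<longlonglongrightarrow> y"
      by (auto simp: set_converges_to_def)
    have "countable A"
      using e(1) by (metis bij_betw_def countableI_type countable_image)
    moreover have "infinite A"
      using e(1) bij_betw_finite by blast
    ultimately show "countable A \<and> infinite A \<and> (\<forall>x. \<forall>\<epsilon>>0. finite {f \<in> A. \<epsilon> \<le> \<bar>f x - y x\<bar>})"
      using conv e by blast
  next
    assume "countable A \<and> infinite A \<and> (\<forall>x. \<forall>\<epsilon>>0. finite {f \<in> A. \<epsilon> \<le> \<bar>f x - y x\<bar>})"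
    then show "set_converges_to A y"
      using conv bij_betw_from_nat_into unfolding set_converges_to_def by blast
  qed
qed

lemma dual_filter_bounded_ideal_iff:
  "S \<in> dual_filter bounded_ideal \<longleftrightarrow> (\<exists>h. {(n, m). h n < m} \<subseteq> S)"
proof
  assume "S \<in> dual_filter bounded_ideal"
  then obtain A h where "S = UNIV - A" "A \<subseteq> A_h h"
    by (auto simp: dual_filter_def bounded_ideal_def)
  then have "{(n, m). h n < m} \<subseteq> S"
    by (auto simp: A_h_def)
  then show "\<exists>h. {(n, m). h n < m} \<subseteq> S" by blast
next
  assume "\<exists>h. {(n, m). h n < m} \<subseteq> S"
  then obtain h where "{(n, m). h n < m} \<subseteq> S" by (rule exE)
  then have "- S \<subseteq> A_h h"
    by (auto simp: A_h_def subset_iff not_less[symmetric])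
  then have "- S \<in> bounded_ideal"
    unfolding bounded_ideal_def by blast
  moreover have "S = UNIV - (- S)"
    by simp
  ultimately show "S \<in> dual_filter bounded_ideal"
    unfolding dual_filter_def by blast
qed

text \<open>Here \<open>h\<close> may depend on \<open>x\<close> and \<open>\<epsilon>\<close>, and
  its values can be chosen separately for each \<open>n\<close>. A bound for every column is thus
  all that is required, which is columnwise convergence.\<close>

lemma I_converges_to_zero_bounded_ideal_iff:
  "I_converges_to_zero bounded_ideal f \<longleftrightarrow> (\<forall>n x. (\<lambda>m. f (n, m) x) \<longlonglongrightarrow> 0)"
proof -
  have "(\<exists>h. {(n, m). h n < m} \<subseteq> {d. \<bar>f d x\<bar> < \<epsilon>}) \<longleftrightarrow> (\<forall>n. finite {m. \<epsilon> \<le> \<bar>f (n, m) x\<bar>})"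
    (is "?L \<longleftrightarrow> ?R") for x \<epsilon>
  proof
    assume ?L
    then obtain h where "{(n, m). h n < m} \<subseteq> {d. \<bar>f d x\<bar> < \<epsilon>}" by (rule exE)
    then have "{m. \<epsilon> \<le> \<bar>f (n, m) x\<bar>} \<subseteq> {..h n}" for n
      by (force simp: subset_iff not_less[symmetric])
    then show ?R
      by (meson finite_atMost finite_subset)
  next
    assume ?R
    then have "\<forall>n. \<exists>k. \<forall>m. \<epsilon> \<le> \<bar>f (n, m) x\<bar> \<longrightarrow> m \<le> k"
      by (simp add: finite_nat_set_iff_bounded_le)
    then obtain h where "\<forall>n m. \<epsilon> \<le> \<bar>f (n, m) x\<bar> \<longrightarrow> m \<le> h n"
      by metis
    then have "{(n, m). h n < m} \<subseteq> {d. \<bar>f d x\<bar> < \<epsilon>}"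
      by (force simp: not_le[symmetric])
    then show ?L by blast
  qed
  then show ?thesis
    unfolding I_converges_to_zero_def dual_filter_bounded_ideal_iff
    by (simp add: LIMSEQ_iff_finite_ge) blast
qed

text \<open>Every set in the dual filter contains the region strictly above some graph, and that
  region is itself in the filter. Shrinking \<open>A\<close> to it preserves convergence, so the
  choice of \<open>A\<close> becomes the choice of one \<open>h\<close> serving all \<open>x\<close>
  and \<open>\<epsilon>\<close>.\<close>

lemma bounded_ideal_convergence_property_iff:
  "bounded_ideal_convergence_property TYPE('a::topological_space) \<longleftrightarrow>
    (\<forall>f :: nat \<times> nat \<Rightarrow> 'a \<Rightarrow> real.
       (\<forall>d. continuous_on UNIV (f d)) \<and> (\<forall>n x. (\<lambda>m. f (n, m) x) \<longlonglongrightarrow> 0) \<longrightarrow>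
       (\<exists>h. \<forall>x. \<forall>\<epsilon>>0. finite {(n, m). h n < m \<and> \<epsilon> \<le> \<bar>f (n, m) x\<bar>}))"
proof -
  have "(\<exists>A \<in> dual_filter bounded_ideal. pointwise_converges_to_zero_on A f) \<longleftrightarrow>
    (\<exists>h. \<forall>x. \<forall>\<epsilon>>0. finite {(n, m). h n < m \<and> \<epsilon> \<le> \<bar>f (n, m) x\<bar>})" (is "?L \<longleftrightarrow> ?R")
    for f :: "nat \<times> nat \<Rightarrow> 'a \<Rightarrow> real"
  proof
    assume ?L
    then obtain A h where A: "{(n, m). h n < m} \<subseteq> A" "pointwise_converges_to_zero_on A f"
      by (auto simp: dual_filter_bounded_ideal_iff)
    have "finite {(n, m). h n < m \<and> \<epsilon> \<le> \<bar>f (n, m) x\<bar>}" if "\<epsilon> > 0" for x \<epsilon>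
    proof (rule finite_subset)
      show "{(n, m). h n < m \<and> \<epsilon> \<le> \<bar>f (n, m) x\<bar>} \<subseteq> {d \<in> A. \<epsilon> \<le> \<bar>f d x\<bar>}"
        using A(1) by auto
    qed (use A(2) that in \<open>simp add: pointwise_converges_to_zero_on_def\<close>)
    then show ?R
      by blast
  next
    assume ?R
    then obtain h where h: "\<forall>x. \<forall>\<epsilon>>0. finite {(n, m). h n < m \<and> \<epsilon> \<le> \<bar>f (n, m) x\<bar>}" ..
    have eq: "{d \<in> {(n, m). h n < m}. \<epsilon> \<le> \<bar>f d x\<bar>} = {(n, m). h n < m \<and> \<epsilon> \<le> \<bar>f (n, m) x\<bar>}" for x \<epsilon>
      by auto
    have "pointwise_converges_to_zero_on {(n, m). h n < m} f"
      unfolding pointwise_converges_to_zero_on_def eq using h by blast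
    moreover have "{(n, m). h n < m} \<in> dual_filter bounded_ideal"
      unfolding dual_filter_bounded_ideal_iff by blast
    ultimately show ?L
      by blast
  qed
  then show ?thesis
    unfolding bounded_ideal_convergence_property_def ideal_convergence_property_def
      I_converges_to_zero_bounded_ideal_iff by simp
qed

section \<open>The convergence property and alpha_1 for C_p(X)\<close>

lemma bounded_ideal_convergence_property_imp_alpha1:
  assumes "bounded_ideal_convergence_property TYPE('a::topological_space)"
  shows "alpha1 (Cp TYPE('a))"
  unfolding alpha1_def
proof (intro ballI allI impI)
  fix y :: "'a \<Rightarrow> real" and A :: "nat \<Rightarrow> ('a \<Rightarrow> real) set"
  assume y: "y \<in> Cp TYPE('a)"
    and A: "\<forall>n. A n \<subseteq> Cp TYPE('a) \<and> countable (A n) \<and> infinite (A n) \<and> set_converges_to (A n) y"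
  then have "\<forall>n. \<exists>e::nat \<Rightarrow> 'a \<Rightarrow> real. bij_betw e UNIV (A n) \<and> e \<longlonglongrightarrow> y"
    by (simp add: set_converges_to_def)
  then obtain e :: "nat \<Rightarrow> nat \<Rightarrow> 'a \<Rightarrow> real"
    where e: "\<And>n. bij_betw (e n) UNIV (A n)" "\<And>n. e n \<longlonglongrightarrow> y"
    by metis
  have range_e: "range (e n) = A n" for n
    using e(1) by (simp add: bij_betw_def)
  define f where "f = (\<lambda>(n, m) x. e n m x - y x)"
  have "continuous_on UNIV (f d)" for d
  proof (cases d)
    case (Pair n m)
    have "e n m \<in> Cp TYPE('a)"
      using A range_e by blast
    then show ?thesis
      using y by (auto simp: f_def Pair Cp_def intro!: continuous_intros)
  qed
  moreover have "(\<lambda>m. f (n, m) x) \<longlonglongrightarrow> 0" for n x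
    using e(2)[of n] by (simp add: f_def tendsto_fun_iff LIM_zero)
  ultimately obtain h where
    h: "\<And>x \<epsilon>. \<epsilon> > 0 \<Longrightarrow> finite {(n, m). h n < m \<and> \<epsilon> \<le> \<bar>f (n, m) x\<bar>}"
    using assms unfolding bounded_ideal_convergence_property_iff by blast
  \<comment> \<open>\<open>h\<close> prescribes the initial segment to drop from each
    enumeration.\<close>
  define B where "B n = e n ` {h n<..}" for n
  have sub: "B n \<subseteq> A n" for n
    using range_e by (auto simp: B_def)
  have cofin: "finite (A n - B n)" for n
  proof (rule finite_subset)
    show "A n - B n \<subseteq> e n ` {..h n}"
      by (force simp: B_def range_e[symmetric] not_less[symmetric])
  qed simp
  \<comment> \<open>A convergent set is enumerated bijectively by all naturals, so the union has to
    be infinite; the cofinite part \<open>B 0\<close> of \<open>A 0\<close> already is.\<close>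
  have "infinite (B 0)"
    using A sub cofin by (metis Diff_infinite_finite double_diff subset_refl finite_Diff2)
  then have "infinite (\<Union>n. B n)"
    by (meson UN_upper UNIV_I infinite_super)
  moreover have "countable (\<Union>n. B n)"
    by (auto simp: B_def)
  moreover have "finite {g \<in> \<Union>n. B n. \<epsilon> \<le> \<bar>g x - y x\<bar>}" if "\<epsilon> > 0" for x \<epsilon>
  proof (rule finite_subset)
    \<comment> \<open>The sets \<open>A n\<close> may overlap, so pairs \<open>(n, m)\<close> only
      map onto the exceptional functions; an image of a finite set suffices.\<close>
    show "{g \<in> \<Union>n. B n. \<epsilon> \<le> \<bar>g x - y x\<bar>} \<subseteq>
      (\<lambda>(n, m). e n m) ` {(n, m). h n < m \<and> \<epsilon> \<le> \<bar>f (n, m) x\<bar>}"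
      by (auto simp: B_def f_def image_iff)
  qed (use h that in blast)
  ultimately have "set_converges_to (\<Union>n. B n) y"
    by (simp add: set_converges_to_real_fun_iff)
  then show "\<exists>B. (\<forall>n. B n \<subseteq> A n \<and> finite (A n - B n)) \<and> set_converges_to (\<Union>n. B n) y"
    using sub cofin by blast
qed

text \<open>For distinct \<open>p\<close>, \<open>q\<close> a collision occurs for only one \<open>t\<close>, so all but countably many \<open>t\<close> work.\<close>

lemma ex_distinguishing_perturbation:
  fixes v c :: "'d::countable \<Rightarrow> real"
  assumes "inj c"
  obtains t where "0 < t" "t < 1" "inj (\<lambda>d. v d + t * c d)"
proof -
  define T where "T = (\<lambda>(p, q). (v q - v p) / (c p - c q)) ` (UNIV :: ('d \<times> 'd) set)"
  have "countable T"
    by (auto simp: T_def)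
  then have "uncountable ({0<..<1::real} - T)"
    by (simp add: uncountable_minus_countable uncountable_open_interval)
  then obtain t where t: "t \<in> {0<..<1}" "t \<notin> T"
    by (metis Diff_iff countable_empty equals0I)
  have "inj (\<lambda>d. v d + t * c d)"
  proof (rule injI, rule ccontr)
    fix p q
    assume eq: "v p + t * c p = v q + t * c q" and "p \<noteq> q"
    then have "c p - c q \<noteq> 0"
      using assms by (auto dest: injD)
    then have "t = (v q - v p) / (c p - c q)"
      using eq by (simp add: field_simps)
    then show False
      using t(2) by (auto simp: T_def)
  qed
  then show thesis
    using t(1) that by auto
qed

text \<open>alpha_1 concerns sets of functions, so coinciding members of a family would merge. The
  perturbed family \<open>g\<close> is injective in the index pair, dominates
  \<open>\<bar>f\<bar>\<close> and still tends to 0 in each column; an \<open>h\<close> for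
  \<open>g\<close> then serves \<open>f\<close>.\<close>

lemma alpha1_imp_bounded_ideal_convergence_property:
  assumes "alpha1 (Cp TYPE('a::topological_space))"
  shows "bounded_ideal_convergence_property TYPE('a)"
  unfolding bounded_ideal_convergence_property_iff
proof (intro allI impI, elim conjE)
  fix f :: "nat \<times> nat \<Rightarrow> 'a \<Rightarrow> real"
  assume cont: "\<forall>d. continuous_on UNIV (f d)" and lim: "\<forall>n x. (\<lambda>m. f (n, m) x) \<longlonglongrightarrow> 0"
  \<comment> \<open>An injective positive weight tending to 0 along each column, since
    \<open>prod_encode (n, m)\<close> is at least \<open>m\<close>; the 1 avoids division by zero at
    code 0.\<close>
  define c :: "nat \<times> nat \<Rightarrow> real" where "c d = 1 / (real (prod_encode d) + 1)" for d
  have "inj c"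
    by (auto simp: c_def intro!: injI dest: injD[OF inj_prod_encode])
  \<comment> \<open>Distinct values at a single point make functions distinct;
    \<open>undefined\<close> serves as that point.\<close>
  then obtain t where t: "0 < t" "t < 1" and inj: "inj (\<lambda>d. \<bar>f d undefined\<bar> + t * c d)"
    by (rule ex_distinguishing_perturbation)
  define g where "g d x = \<bar>f d x\<bar> + t * c d" for d x
  have "inj g"
    using inj unfolding g_def inj_def fun_eq_iff by blast
  have c_pos: "0 < t * c d" for d
    using t by (auto simp: c_def)
  have c_lim: "(\<lambda>m. c (n, m)) \<longlonglongrightarrow> 0" for n
  proof (rule tendsto_sandwich[of "\<lambda>_. 0" _ _ "\<lambda>m. 1 / real (Suc m)"])
    show "\<forall>\<^sub>F m in sequentially. c (n, m) \<le> 1 / real (Suc m)"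
      using le_prod_encode_2[of _ n] by (auto simp: c_def divide_simps intro!: always_eventually)
    show "(\<lambda>m. 1 / real (Suc m)) \<longlonglongrightarrow> 0"
      using LIMSEQ_inverse_real_of_nat by (simp add: inverse_eq_divide)
  qed (simp_all add: c_def)
  have g_lim: "(\<lambda>m. g (n, m)) \<longlonglongrightarrow> (\<lambda>x. 0)" for n
    unfolding tendsto_fun_iff g_def using lim c_lim[of n]
    by (auto intro!: tendsto_eq_intros)
  have g_cont: "continuous_on UNIV (g d)" for d
    unfolding g_def using cont by (intro continuous_on_add continuous_on_rabs continuous_on_const) blast
  define A where "A n = range (\<lambda>m. g (n, m))" for n
  have inj_g: "inj (\<lambda>m. g (n, m))" for n
    using \<open>inj g\<close> by (auto simp: inj_def)
  have zero: "(\<lambda>x. 0) \<in> Cp TYPE('a)"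
    by (simp add: Cp_def)
  have "set_converges_to (A n) (\<lambda>x. 0)" for n
    unfolding set_converges_to_def A_def using g_lim[of n] inj_g by (blast intro: inj_on_imp_bij_betw)
  moreover have "A n \<subseteq> Cp TYPE('a)" for n
    using g_cont by (auto simp: A_def Cp_def)
  ultimately have "\<forall>n. A n \<subseteq> Cp TYPE('a) \<and> countable (A n) \<and> infinite (A n) \<and>
      set_converges_to (A n) (\<lambda>x. 0)"
    by (simp add: set_converges_to_real_fun_iff)
  from mp[OF spec[OF bspec[OF assms[unfolded alpha1_def] zero]] this]
  obtain B where B: "\<forall>n. B n \<subseteq> A n \<and> finite (A n - B n)"
    and conv: "set_converges_to (\<Union>n. B n) (\<lambda>x. 0)"
    by (elim exE conjE)
  have "finite {m. g (n, m) \<notin> B n}" for n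
  proof (rule finite_imageD)
    show "finite ((\<lambda>m. g (n, m)) ` {m. g (n, m) \<notin> B n})"
      by (rule finite_subset[OF _ B[rule_format, THEN conjunct2, of n]]) (auto simp: A_def)
    show "inj_on (\<lambda>m. g (n, m)) {m. g (n, m) \<notin> B n}"
      using inj_g by (rule inj_on_subset) simp
  qed
  \<comment> \<open>Each \<open>B n\<close> omits finitely many functions, hence finitely many
    indices, and \<open>h n\<close> bounds them.\<close>
  then have "\<forall>n. \<exists>k. \<forall>m. g (n, m) \<notin> B n \<longrightarrow> m \<le> k"
    by (simp add: finite_nat_set_iff_bounded_le)
  then obtain h where h: "\<And>n m. g (n, m) \<notin> B n \<Longrightarrow> m \<le> h n"
    by metis
  have "finite {(n, m). h n < m \<and> \<epsilon> \<le> \<bar>f (n, m) x\<bar>}" if "\<epsilon> > 0" for x \<epsilon>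
  proof (rule finite_imageD)
    \<comment> \<open>Finiteness among functions returns to index pairs because \<open>g\<close> is
      injective.\<close>
    have "g ` {(n, m). h n < m \<and> \<epsilon> \<le> \<bar>f (n, m) x\<bar>} \<subseteq> {u \<in> \<Union>n. B n. \<epsilon> \<le> \<bar>u x - 0\<bar>}"
    proof clarsimp
      fix n m
      assume "h n < m" and eps: "\<epsilon> \<le> \<bar>f (n, m) x\<bar>"
      then have "g (n, m) \<in> B n"
        using h by (meson leD)
      moreover have "\<epsilon> \<le> \<bar>g (n, m) x\<bar>"
        using eps c_pos[of "(n, m)"] by (simp add: g_def)
      ultimately show "(\<exists>n'. g (n, m) \<in> B n') \<and> \<epsilon> \<le> \<bar>g (n, m) x\<bar>"
        by blast
    qed
    moreover have "finite {u \<in> \<Union>n. B n. \<epsilon> \<le> \<bar>u x - 0\<bar>}"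
      using conv that unfolding set_converges_to_real_fun_iff by blast
    ultimately show "finite (g ` {(n, m). h n < m \<and> \<epsilon> \<le> \<bar>f (n, m) x\<bar>})"
      by (rule finite_subset)
    show "inj_on g {(n, m). h n < m \<and> \<epsilon> \<le> \<bar>f (n, m) x\<bar>}"
      using \<open>inj g\<close> by (rule inj_on_subset) simp
  qed
  then show "\<exists>h. \<forall>x. \<forall>\<epsilon>>0. finite {(n, m). h n < m \<and> \<epsilon> \<le> \<bar>f (n, m) x\<bar>}"
    by blast
qed

section \<open>From bounded Borel images to the convergence property\<close>

lemma borel_images_bounded_imp_bounded_ideal_convergence_property:
  assumes "borel_images_bounded TYPE('a::topological_space)"
  shows "bounded_ideal_convergence_property TYPE('a)"
  unfolding bounded_ideal_convergence_property_iff
proof (intro allI impI, elim conjE)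
  fix f :: "nat \<times> nat \<Rightarrow> 'a \<Rightarrow> real"
  assume cont: "\<forall>d. continuous_on UNIV (f d)" and lim: "\<forall>n x. (\<lambda>m. f (n, m) x) \<longlonglongrightarrow> 0"
  define \<Psi> where "\<Psi> x n = (LEAST N. \<forall>m\<ge>N. \<bar>f (n, m) x\<bar> \<le> 1 / real (Suc n))" for x n
  have f_meas [measurable]: "f d \<in> borel_measurable borel" for d
    using cont by (blast intro: borel_measurable_continuous_onI)
  \<comment> \<open>The least \<open>N\<close> is determined by countably many Borel conditions on
    \<open>x\<close>.\<close>
  have "(\<lambda>x. \<Psi> x n) \<in> borel \<rightarrow>\<^sub>M count_space UNIV" for n
    unfolding \<Psi>_def by measurable
  then have "\<Psi> \<in> borel_measurable borel"
    by (intro measurable_coordinatewise_then_product) (simp add: measurable_cong_sets[OF refl sets_borel_eq_count_space])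
  then obtain h where h: "\<And>x. finite {n. \<not> \<Psi> x n \<le> h n}"
    using assms unfolding borel_images_bounded_def bounded_baire_def by blast
  have \<Psi>: "\<bar>f (n, m) x\<bar> \<le> 1 / real (Suc n)" if "\<Psi> x n \<le> m" for n m x
  proof -
    have "\<forall>\<^sub>F m in sequentially. \<bar>f (n, m) x\<bar> < 1 / real (Suc n)"
      using lim tendstoD[of "\<lambda>m. f (n, m) x" 0 sequentially "1 / real (Suc n)"]
      by (simp add: dist_real_def)
    then have "\<exists>N. \<forall>m\<ge>N. \<bar>f (n, m) x\<bar> \<le> 1 / real (Suc n)"
      by (meson eventually_sequentially less_imp_le)
    then have "\<forall>m\<ge>\<Psi> x n. \<bar>f (n, m) x\<bar> \<le> 1 / real (Suc n)"
      unfolding \<Psi>_def by (rule LeastI_ex)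
    then show ?thesis
      using that by blast
  qed
  have "finite {(n, m). h n < m \<and> \<epsilon> \<le> \<bar>f (n, m) x\<bar>}" if "\<epsilon> > 0" for x \<epsilon>
  proof -
    obtain N where N: "1 / real (Suc N) < \<epsilon>"
      using \<open>\<epsilon> > 0\<close> nat_approx_posE by blast
    have "finite {m. \<epsilon> \<le> \<bar>f (n, m) x\<bar>}" for n
      using lim \<open>\<epsilon> > 0\<close> by (simp add: LIMSEQ_iff_finite_ge)
    \<comment> \<open>A column with \<open>n > N\<close> and \<open>\<Psi> x n \<le> h n\<close> has
      no exceptional index above \<open>h n\<close>, as there
      \<open>\<bar>f (n, m) x\<bar> \<le> 1 / real (Suc n) < \<epsilon>\<close>. Finitely many
      columns remain, each finite by convergence.\<close>
    then have "finite (SIGMA n:{n. \<not> \<Psi> x n \<le> h n} \<union> {..N}. {m. \<epsilon> \<le> \<bar>f (n, m) x\<bar>})"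
      using h by (intro finite_SigmaI) auto
    moreover have "{(n, m). h n < m \<and> \<epsilon> \<le> \<bar>f (n, m) x\<bar>} \<subseteq>
      (SIGMA n:{n. \<not> \<Psi> x n \<le> h n} \<union> {..N}. {m. \<epsilon> \<le> \<bar>f (n, m) x\<bar>})"
    proof (rule subrelI)
      fix n m
      assume "(n, m) \<in> {(n, m). h n < m \<and> \<epsilon> \<le> \<bar>f (n, m) x\<bar>}"
      then have "h n < m" "\<epsilon> \<le> \<bar>f (n, m) x\<bar>"
        by simp_all
      have "h n < \<Psi> x n \<or> n \<le> N"
      proof (rule ccontr)
        assume *: "\<not> (h n < \<Psi> x n \<or> n \<le> N)"
        then have "\<epsilon> \<le> 1 / real (Suc n)"
          using \<Psi>[of x n m] \<open>h n < m\<close> \<open>\<epsilon> \<le> \<bar>f (n, m) x\<bar>\<close> by linarith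
        also have "\<dots> \<le> 1 / real (Suc N)"
          using * by (simp add: frac_le)
        finally show False
          using N by simp
      qed
      with \<open>\<epsilon> \<le> \<bar>f (n, m) x\<bar>\<close>
      show "(n, m) \<in> (SIGMA n:{n. \<not> \<Psi> x n \<le> h n} \<union> {..N}. {m. \<epsilon> \<le> \<bar>f (n, m) x\<bar>})"
        by auto
    qed
    ultimately show ?thesis
      by (rule rev_finite_subset)
  qed
  then show "\<exists>h. \<forall>x. \<forall>\<epsilon>>0. finite {(n, m). h n < m \<and> \<epsilon> \<le> \<bar>f (n, m) x\<bar>}"
    by blast
qed

section \<open>Clopen families and the collapse of Borel sets to F_sigma sets\<close>

lemma clopen_family_point_finite_tail:
  fixes C :: "nat \<Rightarrow> nat \<Rightarrow> 'a::topological_space set"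
  assumes "bounded_ideal_convergence_property TYPE('a)"
    and clopen: "\<And>n m. open (C n m) \<and> closed (C n m)"
    and fin: "\<And>n x. finite {m. x \<in> C n m}"
  shows "\<exists>h. \<forall>x. finite {(n, m). h n < m \<and> x \<in> C n m}"
proof -
  define f :: "nat \<times> nat \<Rightarrow> 'a \<Rightarrow> real" where "f = (\<lambda>(n, m). indicat_real (C n m))"
  have "continuous_on UNIV (indicat_real (C n m))" for n m
  proof -
    \<comment> \<open>Both \<open>C n m\<close> and its complement are closed, so the two constants
      glue continuously.\<close>
    have "continuous_on (C n m \<union> - C n m) (\<lambda>x. if x \<in> C n m then 1 else 0 :: real)"
      using clopen[of n m] by (intro continuous_on_If) auto
    then show ?thesis
      by (simp add: indicator_def of_bool_def Compl_partition)
  qed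
  then have "\<forall>d. continuous_on UNIV (f d)"
    by (simp add: f_def split_def)
  moreover have "(\<lambda>m. f (n, m) x) \<longlonglongrightarrow> 0" for n x
    unfolding LIMSEQ_iff_finite_ge
    by (auto simp: f_def indicator_def intro!: finite_subset[OF _ fin[of x n]])
  ultimately obtain h where "\<And>x \<epsilon>. \<epsilon> > 0 \<Longrightarrow> finite {(n, m). h n < m \<and> \<epsilon> \<le> \<bar>f (n, m) x\<bar>}"
    using assms(1) unfolding bounded_ideal_convergence_property_iff by blast
  \<comment> \<open>An indicator only takes the values 0 and 1, so the threshold 1 detects
    membership.\<close>
  then have "finite {(n, m). h n < m \<and> 1 \<le> \<bar>f (n, m) x\<bar>}" for x
    by simp
  moreover have "1 \<le> \<bar>f (n, m) x\<bar> \<longleftrightarrow> x \<in> C n m" for n m x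
    by (simp add: f_def indicator_def)
  ultimately have "finite {(n, m). h n < m \<and> x \<in> C n m}" for x
    by simp
  then show ?thesis
    by blast
qed

lemma open_family_disjoint_clopen_union:
  fixes U :: "'i \<Rightarrow> 'a::topological_space set"
  assumes "clopen_countable_union_property TYPE('a)" "\<And>i. open (U i)"
  obtains C :: "'i \<Rightarrow> nat \<Rightarrow> 'a set"
  where "\<And>i j. open (C i j) \<and> closed (C i j)" "\<And>i. disjoint_family (C i)"
    "\<And>i. U i = (\<Union>j. C i j)"
proof -
  have "\<forall>i. \<exists>D :: nat \<Rightarrow> 'a set. (\<forall>j. open (D j) \<and> closed (D j)) \<and> U i = (\<Union>j. D j)"
    using assms unfolding clopen_countable_union_property_def by blast
  from choice[OF this] obtain D :: "'i \<Rightarrow> nat \<Rightarrow> 'a set"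
    where D: "\<forall>i. (\<forall>j. open (D i j) \<and> closed (D i j)) \<and> U i = (\<Union>j. D i j)" ..
  show thesis
  \<comment> \<open>Subtracting the finitely many earlier pieces keeps a clopen set clopen.\<close>
  proof (rule that[of "\<lambda>i. disjointed (D i)"])
    show "open (disjointed (D i) j) \<and> closed (disjointed (D i) j)" for i j
      unfolding disjointed_def using D by (intro conjI open_Diff closed_Diff open_UN closed_UN) auto
    show "disjoint_family (disjointed (D i))" for i
      by (rule disjoint_family_disjointed)
    show "U i = (\<Union>j. disjointed (D i) j)" for i
      using D by (simp add: UN_disjointed_eq)
  qed
qed

lemma disjoint_family_finite_index:
  assumes "disjoint_family C"
  shows "finite {j. x \<in> C j}"
proof -
  have "{j. x \<in> C j} \<subseteq> {i}" if "x \<in> C i" for i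
    using assms that by (auto simp: disjoint_family_on_def)
  then show ?thesis
    by (metis finite.simps finite_subset empty_Collect_eq)
qed

lemma gdelta_imp_fsigma:
  fixes G :: "'a::topological_space set"
  assumes clopen: "clopen_countable_union_property TYPE('a)"
    and conv: "bounded_ideal_convergence_property TYPE('a)"
    and "gdelta_in euclidean G"
  shows "fsigma_in euclidean G"
proof -
  obtain U where U: "\<And>n. open (U n)" "\<And>n. U (Suc n) \<subseteq> U n" and G: "G = (\<Inter>n. U n)"
    using assms(3) unfolding gdelta_in_descending by auto
  have U_mono: "U n \<subseteq> U m" if "m \<le> n" for m n
    using lift_Suc_antimono_le[of U, OF U(2) that] .
  obtain C where C: "\<And>n j. open (C n j) \<and> closed (C n j)" "\<And>n. disjoint_family (C n)"
    and U_eq: "\<And>n. U n = (\<Union>j::nat. C n j)"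
    by (rule open_family_disjoint_clopen_union[of U, OF clopen U(1)]) blast
  from clopen_family_point_finite_tail[of C, OF conv C(1) disjoint_family_finite_index[OF C(2)]]
  obtain h where h: "\<forall>x. finite {(n, m). h n < m \<and> x \<in> C n m}" ..
  \<comment> \<open>\<open>K N\<close> asks for an index at most \<open>h n\<close> at every level
    from \<open>N\<close> on; the inner unions are finite, so it is closed.\<close>
  define K where "K N = (\<Inter>n\<in>{N..}. \<Union>j\<le>h n. C n j)" for N
  have "G = (\<Union>N. K N)"
  proof
    show "G \<subseteq> (\<Union>N. K N)"
    proof
      fix x
      assume "x \<in> G"
      have "finite (fst ` {(n, m). h n < m \<and> x \<in> C n m})"
        using h by blast
      then obtain N where N: "\<forall>n \<in> fst ` {(n, m). h n < m \<and> x \<in> C n m}. n < N"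
        unfolding finite_nat_set_iff_bounded ..
      have "x \<in> (\<Union>j\<le>h n. C n j)" if "N \<le> n" for n
      proof -
        obtain j where j: "x \<in> C n j"
          using \<open>x \<in> G\<close> G U_eq by blast
        have "j \<le> h n"
        proof (rule ccontr)
          assume "\<not> j \<le> h n"
          then have "(n, j) \<in> {(n, m). h n < m \<and> x \<in> C n m}"
            using j by simp
          from bspec[OF N imageI[OF this]] have "n < N"
            by simp
          with that show False
            by simp
        qed
        with j show ?thesis
          by blast
      qed
      then show "x \<in> (\<Union>N. K N)"
        by (auto simp: K_def)
    qed
    show "(\<Union>N. K N) \<subseteq> G"
    proof
      fix x
      assume "x \<in> (\<Union>N. K N)"
      then obtain N where N: "x \<in> K N" ..
      have "x \<in> U n" for n
      proof -
        \<comment> \<open>\<open>K N\<close> gives membership only at levels from \<open>N\<close>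
          on; the descending \<open>U\<close> supplies the earlier ones.\<close>
        have "x \<in> U (max N n)"
          using N unfolding K_def U_eq by fastforce
        then show ?thesis
          using U_mono[of n "max N n"] by auto
      qed
      then show "x \<in> G"
        by (simp add: G)
    qed
  qed
  moreover have "closed (K N)" for N
    unfolding K_def using C(1) by (intro closed_INT ballI closed_UN) auto
  then have "fsigma_in euclidean (K N)" for N
    by (simp add: closed_imp_fsigma_in)
  then have "fsigma_in euclidean (\<Union>(range K))"
    by (intro fsigma_in_Union) auto
  ultimately show ?thesis
    by simp
qed

text \<open>Induction over the generation of the Borel sets. Only complements are delicate: they
  turn F_sigma into G_delta, which \<open>gdelta_imp_fsigma\<close> turns back.\<close>

lemma borel_imp_fsigma:
  fixes S :: "'a::topological_space set"
  assumes clopen: "clopen_countable_union_property TYPE('a)"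
    and conv: "bounded_ideal_convergence_property TYPE('a)"
    and "S \<in> sets borel"
  shows "fsigma_in euclidean S"
proof -
  have "S \<in> sigma_sets UNIV {S. open S}"
    using assms(3) by (simp add: borel_def)
  then show ?thesis
  proof induction
    case (Basic U)
    then obtain C :: "nat \<Rightarrow> 'a set" where "\<And>n. open (C n) \<and> closed (C n)" "U = \<Union>(range C)"
      using clopen unfolding clopen_countable_union_property_def by auto
    then have "fsigma_in euclidean (C n)" for n
      by (simp add: closed_imp_fsigma_in)
    then show ?case
      unfolding \<open>U = \<Union>(range C)\<close> by (intro fsigma_in_Union) auto
  next
    case Empty
    show ?case by simp
  next
    case (Compl S)
    then have "gdelta_in euclidean (UNIV - S)"
      using gdelta_in_diff[OF gdelta_in_topspace[of euclidean]] by simp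
    then show ?case
      by (rule gdelta_imp_fsigma[OF clopen conv])
  next
    case (Union A)
    then show ?case
      by (auto intro!: fsigma_in_Union)
  qed
qed

section \<open>Bounding Borel images\<close>

lemma bounded_ideal_convergence_property_imp_borel_images_bounded:
  assumes clopen: "clopen_countable_union_property TYPE('a::topological_space)"
    and conv: "bounded_ideal_convergence_property TYPE('a)"
  shows "borel_images_bounded TYPE('a)"
  unfolding borel_images_bounded_def bounded_baire_def
proof (intro allI impI)
  fix \<Psi> :: "'a \<Rightarrow> nat \<Rightarrow> nat"
  assume [measurable]: "\<Psi> \<in> borel_measurable borel"
  have meas: "(\<lambda>x. \<Psi> x n) \<in> borel_measurable borel" for n
    by (rule measurable_product_then_coordinatewise) measurable
  have "\<exists>F::nat \<Rightarrow> 'a set. (\<forall>i. closed (F i)) \<and> (\<Union>i. F i) = {x. \<Psi> x (fst p) \<le> snd p}" for p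
  proof -
    have "(\<lambda>x. \<Psi> x (fst p)) -` {..snd p} \<inter> space borel \<in> sets borel"
      using meas by (rule measurable_sets) simp
    then have "fsigma_in euclidean {x. \<Psi> x (fst p) \<le> snd p}"
      by (intro borel_imp_fsigma[OF clopen conv]) (simp add: vimage_def)
    then show ?thesis
      unfolding fsigma_in_ascending closed_closedin by blast
  qed
  then obtain F :: "nat \<times> nat \<Rightarrow> nat \<Rightarrow> 'a set"
    where F: "\<And>p i. closed (F p i)" "\<And>p. (\<Union>i. F p i) = {x. \<Psi> x (fst p) \<le> snd p}"
    by metis
  \<comment> \<open>Bounding both the value \<open>k\<close> and the piece index \<open>i\<close> by
    \<open>j\<close> yields closed sets increasing in \<open>j\<close>, covering the space, with
    \<open>\<Psi> x n \<le> j\<close> on \<open>K n j\<close>. The least \<open>j\<close> with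
    \<open>x \<in> K n j\<close> is the value at \<open>n\<close> of the dominating function
    \<Theta>.\<close>
  define K where "K n j = (\<Union>k\<le>j. \<Union>i\<le>j. F (n, k) i)" for n j
  have K_closed: "closed (K n j)" for n j
    unfolding K_def using F(1) by (intro closed_UN ballI) auto
  have K_mono: "K n i \<subseteq> K n j" if "i \<le> j" for n i j
    unfolding K_def using that by fastforce
  have K_bound: "\<Psi> x n \<le> j" if "x \<in> K n j" for x n j
  proof -
    obtain k i where "k \<le> j" "x \<in> F (n, k) i"
      using \<open>x \<in> K n j\<close> by (auto simp: K_def)
    moreover have "\<Psi> x n \<le> k"
      using \<open>x \<in> F (n, k) i\<close> F(2)[of "(n, k)"] by auto
    ultimately show ?thesis
      by simp
  qed
  have K_cover: "\<exists>j. x \<in> K n j" for x n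
  proof -
    obtain i where "x \<in> F (n, \<Psi> x n) i"
      using F(2)[of "(n, \<Psi> x n)"] by auto
    then have "x \<in> K n (max i (\<Psi> x n))"
      unfolding K_def by (meson UN_I atMost_iff max.cobounded1 max.cobounded2)
    then show ?thesis ..
  qed
  define V where "V p = - K (fst p) (snd p)" for p
  have "open (V p)" for p
    using K_closed by (simp add: V_def open_Compl)
  with clopen obtain C where C: "\<And>p j. open (C p j) \<and> closed (C p j)"
    "\<And>p. disjoint_family (C p)" and V_eq: "\<And>p. V p = (\<Union>j::nat. C p j)"
    by (rule open_family_disjoint_clopen_union[of V]) blast
  have K_eq: "- K n k = (\<Union>j. C (n, k) j)" for n k
    using V_eq[of "(n, k)"] by (simp add: V_def)
  \<comment> \<open>For fixed \<open>n\<close>, the clopen pieces of the complements of all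
    \<open>K n k\<close> are listed in one sequence, as the tail lemma expects.\<close>
  define E where "E n m = (case prod_decode m of (k, j) \<Rightarrow> C (n, k) j)" for n m
  have E_encode: "E n (prod_encode (k, j)) = C (n, k) j" for n k j
    by (simp add: E_def)
  have "finite {m. x \<in> E n m}" for n x
  proof -
    obtain i where i: "x \<in> K n i"
      using K_cover by blast
    \<comment> \<open>Once \<open>x\<close> is in \<open>K n i\<close>, only complements with
      \<open>k \<le> i\<close> can contain it, and disjointness allows at most one piece for
      each.\<close>
    have "{m. x \<in> E n m} \<subseteq> prod_encode ` (SIGMA k:{..i}. {j. x \<in> C (n, k) j})"
    proof
      fix m
      assume m: "m \<in> {m. x \<in> E n m}"
      obtain k j where kj: "prod_decode m = (k, j)"
        by (cases "prod_decode m")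
      then have "x \<in> C (n, k) j"
        using m by (simp add: E_def)
      moreover from this have "x \<notin> K n k"
        using K_eq by blast
      then have "k \<le> i"
        using i K_mono[of i k n] by (meson nat_le_linear subsetD)
      ultimately have "(k, j) \<in> (SIGMA k:{..i}. {j. x \<in> C (n, k) j})"
        by simp
      moreover have "m = prod_encode (k, j)"
        using kj by (metis prod_decode_inverse)
      ultimately show "m \<in> prod_encode ` (SIGMA k:{..i}. {j. x \<in> C (n, k) j})"
        by blast
    qed
    moreover have "finite (SIGMA k:{..i}. {j. x \<in> C (n, k) j})"
      using disjoint_family_finite_index[OF C(2)] by (intro finite_SigmaI) auto
    ultimately show ?thesis
      by (meson finite_imageI finite_subset)
  qed
  moreover have "open (E n m) \<and> closed (E n m)" for n m
    using C(1) by (simp add: E_def split: prod.split)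
  ultimately have "\<exists>h. \<forall>x. finite {(n, m). h n < m \<and> x \<in> E n m}"
    by (intro clopen_family_point_finite_tail[OF conv])
  then obtain h where h: "\<forall>x. finite {(n, m). h n < m \<and> x \<in> E n m}" ..
  have "finite {n. \<not> \<Psi> x n \<le> Suc (h n)}" for x
  proof (rule finite_subset)
    \<comment> \<open>If \<open>x\<close> misses \<open>K n (Suc (h n))\<close>, it lies in a piece
      whose code is at least \<open>Suc (h n)\<close>, hence beyond \<open>h n\<close>. This is why
      the bound is \<open>Suc (h n)\<close>.\<close>
    show "{n. \<not> \<Psi> x n \<le> Suc (h n)} \<subseteq> fst ` {(n, m). h n < m \<and> x \<in> E n m}"
    proof
      fix n
      assume "n \<in> {n. \<not> \<Psi> x n \<le> Suc (h n)}"
      then have "x \<notin> K n (Suc (h n))"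
        using K_bound by blast
      then obtain j where "x \<in> C (n, Suc (h n)) j"
        using K_eq by blast
      moreover have "h n < prod_encode (Suc (h n), j)"
        using le_prod_encode_1[of "Suc (h n)" j] by simp
      ultimately show "n \<in> fst ` {(n, m). h n < m \<and> x \<in> E n m}"
        using E_encode by force
    qed
  qed (use h in blast)
  then show "\<exists>g. \<forall>f\<in>range \<Psi>. finite {n. \<not> f n \<le> g n}"
    by (intro exI[of _ "\<lambda>n. Suc (h n)"]) blast
qed

theorem mainTheorem14:
  assumes "clopen_countable_union_property TYPE('a::topological_space)"
  shows "(bounded_ideal_convergence_property TYPE('a) \<longleftrightarrow> alpha1 (Cp TYPE('a)))
       \<and> (alpha1 (Cp TYPE('a)) \<longleftrightarrow> borel_images_bounded TYPE('a))"
  using assms bounded_ideal_convergence_property_imp_alpha1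
    alpha1_imp_bounded_ideal_convergence_property
    borel_images_bounded_imp_bounded_ideal_convergence_property
    bounded_ideal_convergence_property_imp_borel_images_bounded
  by blast

end
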